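(* Let $T,D,a\in\mathbb{R}$ with $a^2+D^2\neq0$ and let $P:I\to(-\infty,0]$ be the left Poincaré half-map of the system $\dot x=Tx-y$, $\dot y=Dx-a$ associated to $\Sigma=\{x=0\}$. Then $$ \operatorname{sign}\left(\frac{d^2P}{dy_0^2}(y_0)\right)=-\operatorname{sign}(a^2T)\quad\text{for every } y_0\in\operatorname{int}(I). $$
   Context: Let $T,D,a\in\mathbb{R}$ with $a^2+D^2\neq0$ (standing assumption) and consider the planar linear system $\dot x=Tx-y$, $\dot y=Dx-a$, with Poincaré section $\Sigma=\{(x,y)\in\mathbb{R}^2:x=0\}$. Left Poincaré half-map $P$: for $y_0\geqslant0$ let $\Phi(t;y_0)=(\Phi_1(t;y_0),\Phi_2(t;y_0))$ be the solution with $\Phi(0;y_0)=(0,y_0)$. If there exists $\tau(y_0)>0$ such that $\Phi_1(\tau(y_0);y_0)=0$ and $\Phi_1(t;y_0)<0$ for every $t\in(0,\tau(y_0))$, put $P(y_0)=\Phi_2(\tau(y_0);y_0)\leqslant0$. If $P(0)$ is not defined by this rule, but for every $\varepsilon>0$ there exist $y_0\in(0,\varepsilon)$ and $y_1\in(-\varepsilon,0)$ with $P(y_0)=y_1$, then $P$ is extended continuously by $P(0)=0$. The domain of $P$ is the interval $I\subset[0,+\infty)$ of all $y_0$ where $P$ is so defined. $\operatorname{sign}$ takes values in $\{-1,0,1\}$, with $\operatorname{sign}(0)=0$; $\operatorname{int}(I)$ is the interior of $I$. *)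

theory Defs
  imports "HOL-Analysis.Analysis"
begin

definition is_solution :: "real \<Rightarrow> real \<Rightarrow> real \<Rightarrow> (real \<Rightarrow> real \<times> real) \<Rightarrow> bool" where
  "is_solution T D a \<phi> \<longleftrightarrow>
     (\<forall>t. (\<phi> has_vector_derivative
            (T * fst (\<phi> t) - snd (\<phi> t), D * fst (\<phi> t) - a)) (at t))"

text \<open>
  The solution of a linear initial value problem exists on the whole real line and is unique,
  so the quantifier over \<open>\<phi>\<close> ranges over a single curve; the return time \<open>\<tau>\<close> is likewise
  determined by its defining conditions.
\<close>

definition left_return :: "real \<Rightarrow> real \<Rightarrow> real \<Rightarrow> real \<Rightarrow> real \<Rightarrow> bool" where
  "left_return T D a y0 y1 \<longleftrightarrow>
     0 \<le> y0 \<and>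
     (\<exists>\<phi> \<tau>. is_solution T D a \<phi> \<and> \<phi> 0 = (0, y0) \<and>
            0 < \<tau> \<and> fst (\<phi> \<tau>) = 0 \<and> (\<forall>t\<in>{0<..<\<tau>}. fst (\<phi> t) < 0) \<and>
            y1 = snd (\<phi> \<tau>))"

text \<open>The second disjunct is the continuous extension by \<open>P(0) = 0\<close>.\<close>

definition left_half_map_graph :: "real \<Rightarrow> real \<Rightarrow> real \<Rightarrow> real \<Rightarrow> real \<Rightarrow> bool" where
  "left_half_map_graph T D a y0 y1 \<longleftrightarrow>
     left_return T D a y0 y1 \<or>
     (y0 = 0 \<and> y1 = 0 \<and> (\<nexists>z. left_return T D a 0 z) \<and>
      (\<forall>\<epsilon>>0. \<exists>u\<in>{0<..<\<epsilon>}. \<exists>v\<in>{-\<epsilon><..<0}. left_return T D a u v))"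

definition left_half_map_domain :: "real \<Rightarrow> real \<Rightarrow> real \<Rightarrow> real set" where
  "left_half_map_domain T D a = {y0. \<exists>y1. left_half_map_graph T D a y0 y1}"

text \<open>Only the values on \<open>left_half_map_domain T D a\<close> are meaningful.\<close>

definition left_half_map :: "real \<Rightarrow> real \<Rightarrow> real \<Rightarrow> real \<Rightarrow> real" where
  "left_half_map T D a y0 = (THE y1. left_half_map_graph T D a y0 y1)"

end

theory Submission
  imports Defs
begin

text \<open>
  Write \<open>W y = D y\<^sup>2 - a T y + a\<^sup>2\<close> and let \<open>\<tau>\<close> be the return time of \<open>y\<close>. A Wronskian gives
  \<open>P' y = y exp (T \<tau>) / P y\<close>, and a quadratic form in the velocity that grows like \<open>exp (T t)\<close>
  gives \<open>W (P y) = exp (T \<tau>) W y\<close>, so that \<open>P' y = y W (P y) / (P y W y)\<close>. Differentiating this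
  once more yields \<open>P'' = P' a\<^sup>2 (P\<^sup>2 - y\<^sup>2) / (y P\<^sup>2 W y)\<close>. Here \<open>P' < 0 < W y\<close>, and
  \<open>P\<^sup>2 - y\<^sup>2\<close> has the sign of \<open>T\<close> because the energy of the orbit changes at the rate \<open>T x'\<^sup>2\<close>.
\<close>

section \<open>Linear differential equations: components, growth and uniqueness\<close>

lemma is_solution_iff:
  "is_solution T D a \<phi> \<longleftrightarrow>
     (\<forall>t. ((\<lambda>t. fst (\<phi> t)) has_real_derivative T * fst (\<phi> t) - snd (\<phi> t)) (at t)) \<and>
     (\<forall>t. ((\<lambda>t. snd (\<phi> t)) has_real_derivative D * fst (\<phi> t) - a) (at t))"
proof -
  have "(\<phi> has_vector_derivative (v, w)) (at t) \<longleftrightarrow>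
      ((\<lambda>t. fst (\<phi> t)) has_real_derivative v) (at t) \<and>
      ((\<lambda>t. snd (\<phi> t)) has_real_derivative w) (at t)" for v w t
  proof
    assume *: "(\<phi> has_vector_derivative (v, w)) (at t)"
    show "((\<lambda>t. fst (\<phi> t)) has_real_derivative v) (at t) \<and>
      ((\<lambda>t. snd (\<phi> t)) has_real_derivative w) (at t)"
      using bounded_linear.has_vector_derivative[OF bounded_linear_fst *]
        bounded_linear.has_vector_derivative[OF bounded_linear_snd *]
      by (simp add: has_real_derivative_iff_has_vector_derivative)
  next
    assume "((\<lambda>t. fst (\<phi> t)) has_real_derivative v) (at t) \<and>
      ((\<lambda>t. snd (\<phi> t)) has_real_derivative w) (at t)"
    then have "((\<lambda>t. (fst (\<phi> t), snd (\<phi> t))) has_vector_derivative (v, w)) (at t)"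
      by (intro has_vector_derivative_Pair)
        (simp_all add: has_real_derivative_iff_has_vector_derivative)
    then show "(\<phi> has_vector_derivative (v, w)) (at t)" by simp
  qed
  then show ?thesis by (auto simp: is_solution_def)
qed

text \<open>Integrating factor \<open>exp (- T * t)\<close>. It serves for the two determinants
  built from the velocity, which grow at the rate of the trace \<open>T\<close>.\<close>

lemma linear_growth_eq_exp:
  fixes Q :: "real \<Rightarrow> real"
  assumes "\<And>t. (Q has_real_derivative T * Q t) (at t)"
  shows "Q t = exp (T * t) * Q 0"
proof -
  have "((\<lambda>t. Q t * exp (- T * t)) has_real_derivative 0) (at t)" for t
    by (rule derivative_eq_intros assms refl | simp)+
  then have "Q t * exp (- T * t) = Q 0 * exp (- T * 0)"
    by (intro DERIV_isconst_all) auto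
  then show ?thesis by (simp add: exp_minus field_simps)
qed

text \<open>Gronwall argument: \<open>p\<^sup>2 + q\<^sup>2\<close> times a fast enough decaying
  exponential cannot increase, and it starts at 0. For the difference of two solutions this gives
  uniqueness.\<close>

lemma homogeneous_solution_zero:
  fixes p q :: "real \<Rightarrow> real"
  assumes p: "\<And>t. (p has_real_derivative T * p t - q t) (at t)"
    and q: "\<And>t. (q has_real_derivative D * p t) (at t)"
    and "p 0 = 0" "q 0 = 0" and "0 \<le> t"
  shows "p t = 0" "q t = 0"
proof -
  \<comment> \<open>The derivative of \<open>p\<^sup>2 + q\<^sup>2\<close> is
    \<open>2 * T * p\<^sup>2 + 2 * (D - 1) * p * q\<close>; since
    \<open>2 * \<bar>p * q\<bar> \<le> p\<^sup>2 + q\<^sup>2\<close>, it is at most \<open>K\<close>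
    times that sum.\<close>
  define K where "K = 2 * \<bar>T\<bar> + \<bar>D - 1\<bar>"
  define f where "f t = ((p t)\<^sup>2 + (q t)\<^sup>2) * exp (- K * t)" for t
  define g where "g t = (2 * p t * (T * p t - q t) + 2 * q t * (D * p t)
      - K * ((p t)\<^sup>2 + (q t)\<^sup>2)) * exp (- K * t)" for t
  have d: "(f has_real_derivative g t) (at t)" for t
    unfolding f_def[abs_def] g_def
    by (rule derivative_eq_intros p q refl | simp)+ (simp add: algebra_simps)
  have g: "g t \<le> 0" for t
  proof -
    have 1: "2 * T * (p t)\<^sup>2 \<le> 2 * \<bar>T\<bar> * ((p t)\<^sup>2 + (q t)\<^sup>2)"
    proof -
      have "T * (p t)\<^sup>2 \<le> \<bar>T\<bar> * (p t)\<^sup>2" by (intro mult_right_mono) auto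
      moreover have "\<bar>T\<bar> * (p t)\<^sup>2 \<le> \<bar>T\<bar> * ((p t)\<^sup>2 + (q t)\<^sup>2)"
        by (intro mult_left_mono) auto
      ultimately show ?thesis by simp
    qed
    have "2 * (p t * q t) \<le> (p t)\<^sup>2 + (q t)\<^sup>2" "- 2 * (p t * q t) \<le> (p t)\<^sup>2 + (q t)\<^sup>2"
      using zero_le_power2[of "p t - q t"] zero_le_power2[of "p t + q t"]
      by (simp_all add: power2_eq_square algebra_simps)
    then have "\<bar>2 * (p t * q t)\<bar> \<le> (p t)\<^sup>2 + (q t)\<^sup>2" by linarith
    then have "\<bar>D - 1\<bar> * \<bar>2 * (p t * q t)\<bar> \<le> \<bar>D - 1\<bar> * ((p t)\<^sup>2 + (q t)\<^sup>2)"
      by (intro mult_left_mono) auto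
    moreover have "(D - 1) * (2 * (p t * q t)) \<le> \<bar>D - 1\<bar> * \<bar>2 * (p t * q t)\<bar>"
      by (metis abs_ge_self abs_mult)
    ultimately have "2 * p t * (T * p t - q t) + 2 * q t * (D * p t)
      - K * ((p t)\<^sup>2 + (q t)\<^sup>2) \<le> 0"
      using 1 by (simp add: K_def algebra_simps power2_eq_square)
    then show ?thesis unfolding g_def by (intro mult_nonpos_nonneg) auto
  qed
  have "f t \<le> f 0"
    using DERIV_nonpos_imp_nonincreasing[of 0 t f] d g assms(5) by blast
  then have "(p t)\<^sup>2 + (q t)\<^sup>2 \<le> 0"
    by (simp add: f_def assms mult_le_0_iff)
  then show "p t = 0" "q t = 0"
    by (auto simp: sum_power2_le_zero_iff)
qed

section \<open>The orbits as an affine family and their return times\<close>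

text \<open>
  \<open>(x, r)\<close> is the solution through the origin and \<open>(s, u)\<close> solves the homogeneous system from
  \<open>(0, 1)\<close>, so the orbit of \<open>(0, y)\<close> is affine in \<open>y\<close>.
\<close>

locale planar_flow =
  fixes T D a :: real and x r s u :: "real \<Rightarrow> real"
  assumes x: "\<And>t. (x has_real_derivative T * x t - r t) (at t)"
    and r: "\<And>t. (r has_real_derivative D * x t - a) (at t)"
    and s: "\<And>t. (s has_real_derivative T * s t - u t) (at t)"
    and u: "\<And>t. (u has_real_derivative D * s t) (at t)"
    and init [simp]: "x 0 = 0" "r 0 = 0" "s 0 = 0" "u 0 = 1"
begin

definition X where "X y t = x t + y * s t"
definition Y where "Y y t = r t + y * u t"
definition returns where
  "returns y \<tau> \<longleftrightarrow> 0 < \<tau> \<and> X y \<tau> = 0 \<and> (\<forall>t\<in>{0<..<\<tau>}. X y t < 0)"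
text \<open>The form of \<open>invariant_quadratic\<close> at the velocity \<open>(- y, - a)\<close>
  of the point \<open>(0, y)\<close> of the section.\<close>

definition W where "W y = D * y\<^sup>2 - a * T * y + a\<^sup>2"

lemma X0 [simp]: "X y 0 = 0" and Y0 [simp]: "Y y 0 = y"
  by (simp_all add: X_def Y_def)

lemma X_deriv: "(X y has_real_derivative T * X y t - Y y t) (at t)"
  unfolding X_def[abs_def] Y_def
  by (rule derivative_eq_intros x s refl | simp)+ (simp add: algebra_simps)

lemma Y_deriv: "(Y y has_real_derivative D * X y t - a) (at t)"
  unfolding X_def Y_def[abs_def]
  by (rule derivative_eq_intros r u refl | simp)+ (simp add: algebra_simps)

lemma solution_unique:
  assumes "is_solution T D a \<phi>" "\<phi> 0 = (0, y)" "0 \<le> t"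
  shows "\<phi> t = (X y t, Y y t)"
proof -
  have \<phi>: "((\<lambda>t. fst (\<phi> t)) has_real_derivative T * fst (\<phi> t) - snd (\<phi> t)) (at t)"
    "((\<lambda>t. snd (\<phi> t)) has_real_derivative D * fst (\<phi> t) - a) (at t)" for t
    using assms(1) by (auto simp: is_solution_iff)
  have d: "((\<lambda>t. fst (\<phi> t) - X y t) has_real_derivative
        T * (fst (\<phi> t) - X y t) - (snd (\<phi> t) - Y y t)) (at t)"
    "((\<lambda>t. snd (\<phi> t) - Y y t) has_real_derivative D * (fst (\<phi> t) - X y t)) (at t)" for t
    by (rule derivative_eq_intros \<phi> X_deriv Y_deriv refl | simp add: algebra_simps)+
  have "fst (\<phi> t) - X y t = 0" "snd (\<phi> t) - Y y t = 0"
    by (rule homogeneous_solution_zero[OF d]; use assms in simp)+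
  then show ?thesis by (simp add: prod_eq_iff)
qed

lemma left_return_iff:
  "left_return T D a y y1 \<longleftrightarrow> 0 \<le> y \<and> (\<exists>\<tau>. returns y \<tau> \<and> y1 = Y y \<tau>)"
proof
  assume "left_return T D a y y1"
  then obtain \<phi> \<tau> where *: "0 \<le> y" "is_solution T D a \<phi>" "\<phi> 0 = (0, y)" "0 < \<tau>" "fst (\<phi> \<tau>) = 0"
    "\<forall>t\<in>{0<..<\<tau>}. fst (\<phi> t) < 0" "y1 = snd (\<phi> \<tau>)"
    by (auto simp: left_return_def)
  have "\<phi> t = (X y t, Y y t)" if "0 \<le> t" for t
    using solution_unique * that by blast
  with * have "returns y \<tau> \<and> y1 = Y y \<tau>" by (auto simp: returns_def)
  with * show "0 \<le> y \<and> (\<exists>\<tau>. returns y \<tau> \<and> y1 = Y y \<tau>)" by blast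
next
  assume "0 \<le> y \<and> (\<exists>\<tau>. returns y \<tau> \<and> y1 = Y y \<tau>)"
  then obtain \<tau> where "0 \<le> y" "returns y \<tau>" "y1 = Y y \<tau>" by blast
  then show "left_return T D a y y1"
    unfolding left_return_def returns_def
    by (intro conjI exI[of _ "\<lambda>t. (X y t, Y y t)"] exI[of _ \<tau>])
      (auto simp: is_solution_iff X_deriv Y_deriv)
qed

lemma returns_unique:
  assumes "returns y \<tau>" "returns y \<tau>'"
  shows "\<tau> = \<tau>'"
  using assms by (cases \<tau> \<tau>' rule: linorder_cases) (force simp: returns_def)+

text \<open>For \<open>0 < y\<close> the continuous extension is excluded, and the return time is
  unique.\<close>

lemma left_half_map_eq:
  assumes "0 < y" "returns y \<tau>"
  shows "left_half_map T D a y = Y y \<tau>"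
  unfolding left_half_map_def left_half_map_graph_def left_return_iff
  using assms returns_unique by (intro the_equality) auto

lemma domain_returns:
  assumes "y \<in> left_half_map_domain T D a" "0 < y"
  shows "\<exists>\<tau>. returns y \<tau>"
  using assms by (auto simp: left_half_map_domain_def left_half_map_graph_def left_return_iff)

section \<open>Invariants along an orbit and the location of the return point\<close>

text \<open>
  The velocity \<open>(T * X y t - Y y t, D * X y t - a)\<close> solves the homogeneous system, with
  matrix \<open>A\<close> of trace \<open>T\<close>; the two functions below are the determinants of the
  pairs (velocity, \<open>A\<close> velocity) and (velocity, \<open>(s, u)\<close>).
\<close>

lemma invariant_quadratic:
  fixes y
  defines "p \<equiv> \<lambda>t. T * X y t - Y y t" and "m \<equiv> \<lambda>t. D * X y t - a"
  shows "D * (p t)\<^sup>2 - T * p t * m t + (m t)\<^sup>2 = exp (T * t) * W y"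
proof -
  have p: "(p has_real_derivative T * p t - m t) (at t)" for t
    unfolding p_def m_def
    by (rule derivative_eq_intros X_deriv Y_deriv refl)+ (simp add: algebra_simps)
  have m: "(m has_real_derivative D * p t) (at t)" for t
    unfolding p_def m_def
    by (rule derivative_eq_intros X_deriv Y_deriv refl)+ (simp add: algebra_simps)
  have "((\<lambda>t. D * (p t)\<^sup>2 - T * p t * m t + (m t)\<^sup>2) has_real_derivative
      T * (D * (p t)\<^sup>2 - T * p t * m t + (m t)\<^sup>2)) (at t)" for t
    by (rule derivative_eq_intros p m refl)+ (simp add: algebra_simps power2_eq_square)
  from linear_growth_eq_exp[OF this, of t] show ?thesis
    by (simp add: p_def m_def W_def algebra_simps)
qed

lemma wronskian:
  "(T * X y t - Y y t) * u t - (D * X y t - a) * s t = - (y * exp (T * t))"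
proof -
  have "((\<lambda>t. (T * X y t - Y y t) * u t - (D * X y t - a) * s t) has_real_derivative
      T * ((T * X y t - Y y t) * u t - (D * X y t - a) * s t)) (at t)" for t
    by (rule derivative_eq_intros X_deriv Y_deriv s u refl)+ (simp add: algebra_simps)
  from linear_growth_eq_exp[OF this, of t] show ?thesis by simp
qed

lemma return_W:
  assumes "returns y \<tau>"
  shows "W (Y y \<tau>) = exp (T * \<tau>) * W y"
  using invariant_quadratic[of y \<tau>] assms by (simp add: returns_def W_def algebra_simps)

lemma return_wronskian:
  assumes "returns y \<tau>"
  shows "Y y \<tau> * u \<tau> - a * s \<tau> = y * exp (T * \<tau>)"
  using wronskian[of y \<tau>] assms by (simp add: returns_def)

text \<open>
  By Rolle the velocity is vertical somewhere. There the quadratic form is the square of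
  \<open>D * X y t - a\<close>, which is nonzero by the Wronskian.
\<close>

lemma W_pos:
  assumes "returns y \<tau>" "0 < y"
  shows "0 < W y"
proof -
  have "\<exists>z. 0 < z \<and> z < \<tau> \<and> (X y has_real_derivative 0) (at z)"
    using assms(1)
    by (intro Rolle)
      (auto simp: returns_def real_differentiable_def
        intro!: continuous_at_imp_continuous_on DERIV_isCont exI X_deriv)
  then obtain z where "(X y has_real_derivative 0) (at z)" by blast
  from DERIV_unique[OF X_deriv this] have z: "T * X y z - Y y z = 0" .
  have "D * X y z - a \<noteq> 0"
    using wronskian[of y z] z assms(2) by auto
  then have "0 < exp (T * z) * W y"
    using invariant_quadratic[of y z] z zero_less_power2[of "D * X y z - a"] by simp
  then show ?thesis by (simp add: zero_less_mult_iff)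
qed

text \<open>On the section \<open>X' = - Y\<close>, so a positive ordinate at \<open>\<tau>\<close>
  would make \<open>X\<close> positive just before \<open>\<tau>\<close>.\<close>

lemma return_nonpos:
  assumes "returns y \<tau>"
  shows "Y y \<tau> \<le> 0"
proof (rule ccontr)
  assume "\<not> Y y \<tau> \<le> 0"
  then have "T * X y \<tau> - Y y \<tau> < 0" using assms by (simp add: returns_def)
  from DERIV_neg_dec_left[OF X_deriv this] obtain d where
    d: "0 < d" "\<And>h. 0 < h \<Longrightarrow> h < d \<Longrightarrow> X y \<tau> < X y (\<tau> - h)" by blast
  have "0 < \<tau>" using assms by (simp add: returns_def)
  define h where "h = min d \<tau> / 2"
  have "0 < h" "h < d" "h < \<tau>" using d \<open>0 < \<tau>\<close> by (auto simp: h_def)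
  then have "X y \<tau> < X y (\<tau> - h)" "\<tau> - h \<in> {0<..<\<tau>}" using d(2) by auto
  then show False using assms unfolding returns_def by fastforce
qed

text \<open>The energy \<open>(X'\<^sup>2 + D X\<^sup>2) / 2 - a X\<close> has derivative \<open>T X'\<^sup>2\<close>.\<close>

lemma return_energy:
  assumes "returns y \<tau>" "0 < y"
  shows "sgn ((Y y \<tau>)\<^sup>2 - y\<^sup>2) = sgn T"
proof -
  define p where "p t = T * X y t - Y y t" for t
  define E where "E t = (p t)\<^sup>2 / 2 + D * (X y t)\<^sup>2 / 2 - a * X y t" for t
  have E: "(E has_real_derivative T * (p t)\<^sup>2) (at t)" for t
    unfolding E_def[abs_def] p_def
    by (rule derivative_eq_intros X_deriv Y_deriv refl | simp)+
      (simp add: algebra_simps power2_eq_square)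
  have \<tau>: "0 < \<tau>" "X y \<tau> = 0" using assms by (auto simp: returns_def)
  have "sgn (E \<tau> - E 0) = sgn T"
  proof (cases "T = 0")
    case True
    then have "E \<tau> = E 0" using E by (intro DERIV_isconst_all) auto
    then show ?thesis using True by simp
  next
    case False
    \<comment> \<open>Dividing by \<open>T\<close> treats both signs at once: \<open>E / T\<close>
      is nondecreasing, and strictly increasing at the start because \<open>p 0 = - y\<close> is
      nonzero.\<close>
    have F: "((\<lambda>t. E t / T) has_real_derivative (p t)\<^sup>2) (at t)" for t
      using DERIV_cdivide[OF E, of T t] False by simp
    have "0 < (p 0)\<^sup>2" using assms by (simp add: p_def)
    from DERIV_pos_inc_right[OF F this] obtain d where
      d: "0 < d" "\<And>h. 0 < h \<Longrightarrow> h < d \<Longrightarrow> E 0 / T < E (0 + h) / T" by blast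
    define h where "h = min d \<tau> / 2"
    have h: "0 < h" "h < d" "h < \<tau>" using d \<tau> by (auto simp: h_def)
    have "E h / T \<le> E \<tau> / T"
      by (rule DERIV_nonneg_imp_nondecreasing[of h \<tau> "\<lambda>t. E t / T"])
        (use h F in \<open>auto intro: zero_le_power2\<close>)
    with d(2)[OF h(1,2)] have "0 < (E \<tau> - E 0) / T" by (simp add: diff_divide_distrib)
    then show ?thesis by (auto simp: zero_less_divide_iff)
  qed
  moreover have "E \<tau> - E 0 = ((Y y \<tau>)\<^sup>2 - y\<^sup>2) / 2"
    using \<tau> by (simp add: E_def p_def diff_divide_distrib)
  ultimately show ?thesis by (simp add: sgn_divide)
qed

section \<open>Orbits of nearby initial points\<close>

lemma X_change: "X z t = X y t + (z - y) * s t"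
  by (simp add: X_def algebra_simps)

lemma X_neg_near_0:
  assumes "0 < y"
  shows "\<exists>d>0. \<forall>t. 0 < t \<longrightarrow> t < d \<longrightarrow> X y t < 0"
proof -
  have "T * X y 0 - Y y 0 < 0" using assms by simp
  from DERIV_neg_dec_right[OF X_deriv this] show ?thesis by auto
qed

text \<open>Since \<open>X y0\<close> vanishes at time 0, compactness alone is not enough. For small
  \<open>t\<close>, \<open>X y t\<close> is affine in \<open>y\<close> and thus bounded by its
  values at \<open>y0 / 2\<close> and \<open>2 * y0\<close>, both negative. On the remaining compact
  interval \<open>X y0\<close> stays away from 0 and \<open>s\<close> is bounded.\<close>

lemma X_neg_persists:
  assumes "0 < y0" and neg: "\<forall>t\<in>{0<..<\<tau>}. X y0 t < 0" and "c < \<tau>"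
  shows "\<forall>\<^sub>F y in nhds y0. \<forall>t\<in>{0<..c}. X y t < 0"
proof -
  obtain d1 where d1: "0 < d1" "\<And>t. 0 < t \<Longrightarrow> t < d1 \<Longrightarrow> X (y0 / 2) t < 0"
    using X_neg_near_0[of "y0 / 2"] assms by auto
  obtain d2 where d2: "0 < d2" "\<And>t. 0 < t \<Longrightarrow> t < d2 \<Longrightarrow> X (2 * y0) t < 0"
    using X_neg_near_0[of "2 * y0"] assms by auto
  define d where "d = min d1 d2 / 2"
  have d: "0 < d" "d < d1" "d < d2" using d1 d2 by (auto simp: d_def)
  have early: "X y t < 0" if "y0 / 2 \<le> y" "y \<le> 2 * y0" "0 < t" "t \<le> d" for y t
  proof -
    have "X (y0 / 2) t < 0" "X (2 * y0) t < 0" using d1(2) d2(2) d that by auto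
    moreover have "X y t \<le> max (X (y0 / 2) t) (X (2 * y0) t)"
      using that mult_right_mono[of y "2 * y0" "s t"] mult_right_mono_neg[of "y0 / 2" y "s t"]
      unfolding X_def le_max_iff_disj by linarith
    ultimately show ?thesis by linarith
  qed
  have cs: "continuous_on {d..c} (\<lambda>t. \<bar>s t\<bar>)" "continuous_on {d..c} (X y0)"
    by (intro continuous_intros continuous_at_imp_continuous_on ballI DERIV_isCont[OF s]
        DERIV_isCont[OF X_deriv])+
  have "\<exists>e>0. \<forall>y t. \<bar>y - y0\<bar> < e \<longrightarrow> t \<in> {d..c} \<longrightarrow> X y t < 0"
  proof (cases "d \<le> c")
    case True
    obtain t1 where t1: "t1 \<in> {d..c}" "\<And>t. t \<in> {d..c} \<Longrightarrow> \<bar>s t\<bar> \<le> \<bar>s t1\<bar>"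
      using continuous_attains_sup[OF _ _ cs(1)] True by auto
    obtain t2 where t2: "t2 \<in> {d..c}" "\<And>t. t \<in> {d..c} \<Longrightarrow> X y0 t \<le> X y0 t2"
      using continuous_attains_sup[OF _ _ cs(2)] True by auto
    have m: "X y0 t2 < 0" using neg t2(1) d assms by auto
    \<comment> \<open>The distance of \<open>X y0\<close> from 0 on \<open>{d..c}\<close>, divided
      by a bound for \<open>\<bar>s\<bar>\<close>; adding 1 keeps the divisor positive.\<close>
    define e where "e = - X y0 t2 / (\<bar>s t1\<bar> + 1)"
    have "0 < e" using m by (auto simp: e_def intro!: divide_neg_pos)
    moreover have "X y t < 0" if "\<bar>y - y0\<bar> < e" "t \<in> {d..c}" for y t
    proof -
      have "(y - y0) * s t \<le> \<bar>y - y0\<bar> * \<bar>s t\<bar>" by (metis abs_ge_self abs_mult)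
      also have "\<dots> \<le> \<bar>y - y0\<bar> * (\<bar>s t1\<bar> + 1)"
        using t1(2)[OF that(2)] by (intro mult_left_mono) auto
      also have "\<dots> < e * (\<bar>s t1\<bar> + 1)"
        using that by (intro mult_strict_right_mono) auto
      also have "\<dots> = - X y0 t2" by (simp add: e_def)
      finally show ?thesis using X_change[of y t y0] t2(2)[OF that(2)] by linarith
    qed
    ultimately show ?thesis by blast
  qed (auto intro: exI[of _ 1])
  then obtain e where e: "0 < e" "\<And>y t. \<bar>y - y0\<bar> < e \<Longrightarrow> t \<in> {d..c} \<Longrightarrow> X y t < 0" by blast
  have "\<forall>\<^sub>F y in nhds y0. \<bar>y - y0\<bar> < min e (y0 / 2)"
    unfolding eventually_nhds_metric dist_real_def
    using e assms by (intro exI[of _ "min e (y0 / 2)"]) auto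
  then show ?thesis
  proof eventually_elim
    case (elim y)
    then have "y0 / 2 \<le> y" "y \<le> 2 * y0" "\<bar>y - y0\<bar> < e"
      using assms(1) by (auto simp: abs_if split: if_splits)
    then show ?case using early e(2) by (metis atLeastAtMost_iff greaterThanAtMost_iff linear)
  qed
qed

lemma return_time_after:
  assumes "returns y \<tau>" "\<forall>t\<in>{0<..c}. X y t < 0"
  shows "c < \<tau>"
  using assms by (force simp: returns_def)

section \<open>Transversality at the return point\<close>

text \<open>
  If the orbit of \<open>y0\<close> returned at the origin, it would be tangent to the section there with
  \<open>a < 0\<close>, \<open>T < 0\<close>, \<open>D > 0\<close>. Orbits from \<open>y < y0\<close> would then miss the section near the time \<open>\<tau>0\<close>
  and return later by at least a fixed \<open>\<delta>\<close>. But \<open>W\<close> is at least \<open>W 0 = a\<^sup>2\<close> on the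
  negative axis, so \<open>exp (T * (\<tau>0 + \<delta>)) * W y \<ge> exp (T * \<tau>0) * W y0\<close>, which is false as \<open>y\<close> tends
  to \<open>y0\<close>.
\<close>

lemma return_neg:
  assumes "0 < y0" and ret: "returns y0 \<tau>0" and ev: "\<forall>\<^sub>F y in nhds y0. \<exists>\<tau>. returns y \<tau>"
  shows "Y y0 \<tau>0 < 0"
proof (rule ccontr)
  assume "\<not> Y y0 \<tau>0 < 0"
  then have Y: "Y y0 \<tau>0 = 0" using return_nonpos[OF ret] by simp
  have \<tau>0: "0 < \<tau>0" "X y0 \<tau>0 = 0" and neg: "\<forall>t\<in>{0<..<\<tau>0}. X y0 t < 0"
    using ret by (auto simp: returns_def)
  define p where "p t = T * X y0 t - Y y0 t" for t
  have p: "(p has_real_derivative T * p t - (D * X y0 t - a)) (at t)" for t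
    unfolding p_def[abs_def]
    by (rule derivative_eq_intros X_deriv Y_deriv refl)+ (simp add: algebra_simps)
  have p\<tau>: "p \<tau>0 = 0" "(p has_real_derivative a) (at \<tau>0)"
    using p[of \<tau>0] Y \<tau>0 by (simp_all add: p_def)
  have Xp: "(X y0 has_real_derivative p t) (at t)" for t
    unfolding p_def by (rule X_deriv)
  \<comment> \<open>With \<open>Y y0 \<tau>0 = 0\<close> the Wronskian identity reads
    \<open>- (a * s \<tau>0) = y0 * exp (T * \<tau>0)\<close>.\<close>
  have as: "a * s \<tau>0 < 0" using return_wronskian[OF ret] Y assms(1)
    by (metis add.inverse_inverse diff_0 exp_gt_zero mult_pos_pos mult_zero_left neg_less_0_iff_less)
  \<comment> \<open>If \<open>a\<close> were positive, \<open>p = X'\<close> would be negative just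
    before \<open>\<tau>0\<close>, and \<open>X y0\<close> would decrease to 0 from positive
    values.\<close>
  have a: "a < 0"
  proof (rule ccontr)
    assume "\<not> a < 0"
    with as have "0 < a" by (cases "a = 0") auto
    from DERIV_pos_inc_left[OF p\<tau>(2) this] obtain d where
      d: "0 < d" "\<And>h. 0 < h \<Longrightarrow> h < d \<Longrightarrow> p (\<tau>0 - h) < 0"
      using p\<tau> by auto
    define h where "h = min d \<tau>0 / 2"
    have h: "0 < h" "h < d" "h < \<tau>0" using d \<tau>0 by (auto simp: h_def)
    obtain z where z: "\<tau>0 - h < z" "z < \<tau>0" "X y0 \<tau>0 - X y0 (\<tau>0 - h) = (\<tau>0 - (\<tau>0 - h)) * p z"
      using MVT2[of "\<tau>0 - h" \<tau>0 "X y0" p] Xp h by auto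
    have "p z < 0" using d(2)[of "\<tau>0 - z"] z h by simp
    then have "h * p z < 0" using h by (simp add: mult_less_0_iff)
    then have "0 < X y0 (\<tau>0 - h)" using z(3) \<tau>0 by simp
    moreover have "\<tau>0 - h \<in> {0<..<\<tau>0}" using h by auto
    ultimately show False using neg by fastforce
  qed
  have s_pos: "0 < s \<tau>0" using as a by (simp add: mult_less_0_iff)
  have T: "T < 0"
  proof -
    have "sgn T = -1" using return_energy[OF ret assms(1)] Y assms(1) by simp
    then show ?thesis by (simp add: sgn_if split: if_splits)
  qed
  \<comment> \<open>Otherwise \<open>Y' = D * X - a\<close> is nonnegative up to
    \<open>\<tau>0\<close>, and the ordinate cannot fall from \<open>y0\<close> to 0.\<close>
  have D: "0 < D"
  proof (rule ccontr)
    assume "\<not> 0 < D"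
    then have nonneg: "0 \<le> D * X y0 t - a" if "0 \<le> t" "t \<le> \<tau>0" for t
    proof -
      have "X y0 t \<le> 0" using that neg \<tau>0 by (cases "t = 0 \<or> t = \<tau>0") (auto intro: less_imp_le)
      then have "0 \<le> D * X y0 t" using \<open>\<not> 0 < D\<close> by (intro mult_nonpos_nonpos) auto
      then show ?thesis using a by simp
    qed
    have "Y y0 0 \<le> Y y0 \<tau>0"
      by (rule DERIV_nonneg_imp_nondecreasing[of 0 \<tau>0 "Y y0"])
        (use \<tau>0 Y_deriv nonneg in \<open>blast intro: less_imp_le\<close>)+
    then show False using Y assms(1) by simp
  qed
  obtain d where d: "0 < d" "\<And>h. 0 < h \<Longrightarrow> h < d \<Longrightarrow> p (\<tau>0 + h) < 0"
    using DERIV_neg_dec_right[OF p\<tau>(2) a] p\<tau> by auto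
  obtain e where e: "0 < e" "\<And>t. \<bar>t - \<tau>0\<bar> < e \<Longrightarrow> 0 < s t"
  proof -
    have "\<forall>\<^sub>F t in nhds \<tau>0. 0 < s t"
      using order_tendstoD(1)[OF DERIV_isCont[OF s, unfolded isCont_def] s_pos] s_pos
      by (simp add: eventually_nhds_conv_at)
    then show ?thesis using that by (auto simp: eventually_nhds_metric dist_real_def)
  qed
  \<comment> \<open>Within \<open>\<delta>\<close> of \<open>\<tau>0\<close> the function
    \<open>s\<close> is positive, and \<open>p\<close> is negative on the part after
    \<open>\<tau>0\<close>; hence \<open>X y0\<close> only touches 0 at
    \<open>\<tau>0\<close>.\<close>
  define \<delta> where "\<delta> = min (min d e) \<tau>0 / 2"
  have \<delta>: "0 < \<delta>" "\<delta> < d" "\<delta> < e" "\<delta> < \<tau>0" using d e \<tau>0 by (auto simp: \<delta>_def)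
  have X_le: "X y0 t \<le> 0" if t: "0 < t" "t \<le> \<tau>0 + \<delta>" for t
  proof (cases "t \<le> \<tau>0")
    case True
    then show ?thesis using t neg \<tau>0 by (cases "t = \<tau>0") (auto intro: less_imp_le)
  next
    case False
    then obtain z where z: "\<tau>0 < z" "z < t" "X y0 t - X y0 \<tau>0 = (t - \<tau>0) * p z"
      using MVT2[of \<tau>0 t "X y0" p] Xp by auto
    have "p z < 0" using d(2)[of "z - \<tau>0"] z \<delta> t by simp
    then show ?thesis using z False \<tau>0 by (simp add: mult_le_0_iff)
  qed
  have lower: "a\<^sup>2 \<le> W v" if "v \<le> 0" for v
  proof -
    have "0 \<le> D * v\<^sup>2" using D by simp
    moreover have "0 < a * T" using a T by (rule mult_neg_neg)
    then have "a * T * v \<le> 0" using that by (simp add: mult_nonneg_nonpos)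
    ultimately show ?thesis by (simp add: W_def)
  qed
  have "\<forall>\<^sub>F y in nhds y0. 0 < y"
    using assms(1) by (intro eventually_nhds_in_open[of "{0<..}", simplified]) auto
  with X_neg_persists[OF assms(1) neg, of "\<tau>0 - \<delta>"] \<delta> ev
  have "\<forall>\<^sub>F y in nhds y0. (\<forall>t\<in>{0<..\<tau>0 - \<delta>}. X y t < 0) \<and> (\<exists>\<tau>. returns y \<tau>) \<and> 0 < y"
    by (simp add: eventually_conj)
  \<comment> \<open>Only from the left: for \<open>y < y0\<close> and \<open>s t > 0\<close> the
    term \<open>(y - y0) * s t\<close> pushes \<open>X y t\<close> strictly below
    \<open>X y0 t\<close>.\<close>
  then have "\<forall>\<^sub>F y in at_left y0. (\<forall>t\<in>{0<..\<tau>0 - \<delta>}. X y t < 0) \<and> (\<exists>\<tau>. returns y \<tau>) \<and> 0 < y"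
    by (simp add: eventually_at_filter eventually_mono)
  moreover have "\<forall>\<^sub>F y in at_left y0. y < y0" by (simp add: eventually_at_filter)
  ultimately have "\<forall>\<^sub>F y in at_left y0. a\<^sup>2 \<le> exp (T * (\<tau>0 + \<delta>)) * W y"
  proof eventually_elim
    case (elim y)
    then obtain \<tau> where \<tau>: "returns y \<tau>" by blast
    have "X y t < 0" if t: "t \<in> {0<..\<tau>0 + \<delta>}" for t
    proof (cases "t \<le> \<tau>0 - \<delta>")
      case True
      then show ?thesis using elim t by auto
    next
      case False
      then have "0 < s t" using e(2)[of t] t \<delta> by auto
      then have "(y - y0) * s t < 0" using elim by (simp add: mult_less_0_iff)
      then show ?thesis using X_le[of t] t X_change[of y t y0] by auto
    qed
    then have "\<tau>0 + \<delta> < \<tau>" by (intro return_time_after[OF \<tau>]) auto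
    then have "exp (T * \<tau>) * W y \<le> exp (T * (\<tau>0 + \<delta>)) * W y"
      using T W_pos[OF \<tau>] elim by (intro mult_right_mono) auto
    then show ?case using lower[OF return_nonpos[OF \<tau>]] return_W[OF \<tau>] by simp
  qed
  moreover have "((\<lambda>y. exp (T * (\<tau>0 + \<delta>)) * W y) \<longlongrightarrow> exp (T * (\<tau>0 + \<delta>)) * W y0) (at_left y0)"
    unfolding W_def by (intro tendsto_intros)
  ultimately have "a\<^sup>2 \<le> exp (T * (\<tau>0 + \<delta>)) * W y0"
    by (intro tendsto_lowerbound) auto
  moreover have "a\<^sup>2 = exp (T * \<tau>0) * W y0"
    using return_W[OF ret] Y by (simp add: W_def)
  moreover have "exp (T * (\<tau>0 + \<delta>)) * W y0 < exp (T * \<tau>0) * W y0"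
    using T \<delta> W_pos[OF ret assms(1)] by (intro mult_strict_right_mono) auto
  ultimately show False by simp
qed

section \<open>The first derivative\<close>

text \<open>Implicit differentiation of \<open>X y (\<tau> y) = 0\<close>: by
  \<open>return_neg\<close> the orbit of \<open>y0\<close> crosses the section with
  \<open>X' = - Y y0 \<tau>0 > 0\<close>. The continuity of \<open>\<tau>\<close> at
  \<open>y0\<close> is shown first.\<close>

lemma half_map_deriv:
  assumes "0 < y0" and ret: "returns y0 \<tau>0" and ev: "\<forall>\<^sub>F y in nhds y0. \<exists>\<tau>. returns y \<tau>"
  shows "(left_half_map T D a has_real_derivative
           y0 * W (Y y0 \<tau>0) / (Y y0 \<tau>0 * W y0)) (at y0)"
proof -
  have Yneg: "Y y0 \<tau>0 < 0" using return_neg[OF assms] .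
  have \<tau>0: "0 < \<tau>0" "X y0 \<tau>0 = 0" and neg: "\<forall>t\<in>{0<..<\<tau>0}. X y0 t < 0"
    using ret by (auto simp: returns_def)
  define \<tau> where "\<tau> y = (SOME t. returns y t)" for y
  have evr: "\<forall>\<^sub>F y in nhds y0. returns y (\<tau> y)"
    using ev by eventually_elim (simp add: \<tau>_def someI_ex)
  then have "returns y0 (\<tau> y0)" by (rule eventually_nhds_x_imp_x)
  then have \<tau>y0: "\<tau> y0 = \<tau>0" using ret returns_unique by blast
  have lim: "(\<tau> \<longlongrightarrow> \<tau>0) (nhds y0)"
  proof (rule order_tendstoI)
    fix c assume "c < \<tau>0"
    from X_neg_persists[OF assms(1) neg this] evr show "\<forall>\<^sub>F y in nhds y0. c < \<tau> y"
      by eventually_elim (rule return_time_after)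
  next
    \<comment> \<open>Just after \<open>\<tau>0\<close> the orbit of \<open>y0\<close> has crossed
      to the positive side; nearby orbits have done so too, hence have already returned.\<close>
    fix c assume c: "\<tau>0 < c"
    have "0 < T * X y0 \<tau>0 - Y y0 \<tau>0" using \<tau>0 Yneg by simp
    from DERIV_pos_inc_right[OF X_deriv this] obtain d where
      d: "0 < d" "\<And>h. 0 < h \<Longrightarrow> h < d \<Longrightarrow> 0 < X y0 (\<tau>0 + h)" using \<tau>0 by auto
    define h where "h = min d (c - \<tau>0) / 2"
    have h: "0 < h" "h < d" "\<tau>0 + h < c" using d c by (auto simp: h_def min_def field_simps)
    have "((\<lambda>y. X y (\<tau>0 + h)) \<longlongrightarrow> X y0 (\<tau>0 + h)) (nhds y0)"
      unfolding X_def by (intro tendsto_intros filterlim_ident)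
    from order_tendstoD(1)[OF this d(2)[OF h(1,2)]] evr show "\<forall>\<^sub>F y in nhds y0. \<tau> y < c"
    proof eventually_elim
      case (elim y)
      have "\<not> \<tau>0 + h < \<tau> y"
      proof
        assume "\<tau>0 + h < \<tau> y"
        then have "\<tau>0 + h \<in> {0<..<\<tau> y}" using h \<tau>0 by auto
        then show False using elim unfolding returns_def by fastforce
      qed
      then show ?case using h by simp
    qed
  qed
  have lim_at: "(\<tau> \<longlongrightarrow> \<tau>0) (at y0)"
    using lim by (rule tendsto_mono[rotated]) (simp add: at_within_def)
  \<comment> \<open>Caratheodory's slope function turns \<open>X y (\<tau> y) = 0\<close> into
    \<open>g (\<tau> y) * (\<tau> y - \<tau>0) = - (y - y0) * s (\<tau> y)\<close>, so the
    difference quotient of \<open>\<tau>\<close> is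
    \<open>- s (\<tau> y) / g (\<tau> y)\<close>.\<close>
  obtain g where g: "\<And>z. X y0 z - X y0 \<tau>0 = g z * (z - \<tau>0)" "isCont g \<tau>0" "g \<tau>0 = - Y y0 \<tau>0"
    using X_deriv[of y0 \<tau>0] \<tau>0 by (auto simp: CARAT_DERIV)
  have glim: "((\<lambda>y. g (\<tau> y)) \<longlongrightarrow> - Y y0 \<tau>0) (at y0)"
    using isCont_tendsto_compose[OF g(2) lim_at] g(3) by simp
  have slim: "((\<lambda>y. s (\<tau> y)) \<longlongrightarrow> s \<tau>0) (at y0)"
    using isCont_tendsto_compose[OF DERIV_isCont[OF s] lim_at] by simp
  have "((\<lambda>y. (\<tau> y - \<tau> y0) / (y - y0)) \<longlongrightarrow> - s \<tau>0 / - Y y0 \<tau>0) (at y0)"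
  proof (rule Lim_transform_eventually)
    show "((\<lambda>y. - s (\<tau> y) / g (\<tau> y)) \<longlongrightarrow> - s \<tau>0 / - Y y0 \<tau>0) (at y0)"
      using Yneg by (intro tendsto_intros slim glim) auto
    have "\<forall>\<^sub>F y in at y0. 0 < g (\<tau> y)"
      using order_tendstoD(1)[OF glim] Yneg by simp
    moreover have "\<forall>\<^sub>F y in at y0. returns y (\<tau> y) \<and> y \<noteq> y0"
      using evr by (auto simp: eventually_at_filter elim: eventually_mono)
    ultimately show "\<forall>\<^sub>F y in at y0. - s (\<tau> y) / g (\<tau> y) = (\<tau> y - \<tau> y0) / (y - y0)"
    proof eventually_elim
      case (elim y)
      then have "g (\<tau> y) * (\<tau> y - \<tau>0) + (y - y0) * s (\<tau> y) = 0"
        using g(1)[of "\<tau> y"] \<tau>0 X_change[of y "\<tau> y" y0] by (simp add: returns_def)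
      then show ?case using elim \<tau>y0 by (simp add: field_simps)
    qed
  qed
  then have d\<tau>: "(\<tau> has_real_derivative s \<tau>0 / Y y0 \<tau>0) (at y0)"
    by (simp add: has_field_derivative_iff)
  have dr: "((\<lambda>y. r (\<tau> y)) has_real_derivative (D * x \<tau>0 - a) * (s \<tau>0 / Y y0 \<tau>0)) (at y0)"
    by (rule DERIV_chain2[OF _ d\<tau>]) (simp add: \<tau>y0 r)
  have du: "((\<lambda>y. u (\<tau> y)) has_real_derivative D * s \<tau>0 * (s \<tau>0 / Y y0 \<tau>0)) (at y0)"
    by (rule DERIV_chain2[OF _ d\<tau>]) (simp add: \<tau>y0 u)
  have "((\<lambda>y. r (\<tau> y) + y * u (\<tau> y)) has_real_derivative
      (D * x \<tau>0 - a) * (s \<tau>0 / Y y0 \<tau>0) + (u \<tau>0 + y0 * (D * s \<tau>0 * (s \<tau>0 / Y y0 \<tau>0)))) (at y0)"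
    by (rule DERIV_cong[OF DERIV_add[OF dr DERIV_mult[OF DERIV_ident du]]]) (simp add: \<tau>y0)
  moreover have "(D * x \<tau>0 - a) * (s \<tau>0 / Y y0 \<tau>0) + (u \<tau>0 + y0 * (D * s \<tau>0 * (s \<tau>0 / Y y0 \<tau>0)))
      = u \<tau>0 + (D * X y0 \<tau>0 - a) * s \<tau>0 / Y y0 \<tau>0"
    using Yneg by (simp add: X_def field_simps)
  \<comment> \<open>As \<open>X y0 \<tau>0 = 0\<close>, the Wronskian identity gives
    \<open>y0 * exp (T * \<tau>0) / Y y0 \<tau>0\<close>, and \<open>return_W\<close> replaces the
    exponential by a quotient of values of \<open>W\<close>.\<close>
  moreover have "\<dots> = y0 * W (Y y0 \<tau>0) / (Y y0 \<tau>0 * W y0)"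
    using return_wronskian[OF ret] return_W[OF ret] W_pos[OF ret assms(1)] Yneg \<tau>0
    by (simp add: field_simps)
  moreover have "(\<lambda>y. r (\<tau> y) + y * u (\<tau> y)) = (\<lambda>y. Y y (\<tau> y))"
    by (simp add: Y_def)
  ultimately have dY: "((\<lambda>y. Y y (\<tau> y)) has_real_derivative y0 * W (Y y0 \<tau>0) / (Y y0 \<tau>0 * W y0)) (at y0)"
    by (simp only:)
  have "\<forall>\<^sub>F y in nhds y0. 0 < y"
    using assms(1) by (intro eventually_nhds_in_open[of "{0<..}", simplified]) auto
  then have eq: "\<forall>\<^sub>F y in nhds y0. Y y (\<tau> y) = left_half_map T D a y"
    using evr by eventually_elim (simp add: left_half_map_eq)
  from dY show ?thesis
    by (rule DERIV_cong_ev[THEN iffD1, OF refl eq refl])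
qed

section \<open>The second derivative and its sign\<close>

lemma half_map_second_deriv:
  assumes "open S" "y0 \<in> S" and S: "\<And>y. y \<in> S \<Longrightarrow> 0 < y \<and> (\<exists>\<tau>. returns y \<tau>)"
  shows "(\<forall>\<^sub>F y in nhds y0. left_half_map T D a differentiable (at y)) \<and>
    deriv (left_half_map T D a) differentiable (at y0) \<and>
    sgn (deriv (deriv (left_half_map T D a)) y0) = - sgn (a\<^sup>2 * T)"
proof -
  define P where "P = left_half_map T D a"
  define F where "F y = y * W (P y) / (P y * W y)" for y
  have P: "(P has_real_derivative F y) (at y)" if y: "y \<in> S" for y
  proof -
    obtain \<tau> where \<tau>: "0 < y" "returns y \<tau>" using S[OF y] by blast
    have "\<forall>\<^sub>F z in nhds y. \<exists>\<tau>. returns z \<tau>"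
      using eventually_nhds_in_open[OF assms(1) y] by eventually_elim (use S in blast)
    from half_map_deriv[OF \<tau> this] show ?thesis
      using left_half_map_eq[OF \<tau>] by (simp add: P_def F_def)
  qed
  have evS: "\<forall>\<^sub>F y in nhds y0. y \<in> S" using eventually_nhds_in_open[OF assms(1,2)] .
  \<comment> \<open>The formula for \<open>P'\<close> holds on a whole neighbourhood of
    \<open>y0\<close>, so \<open>deriv P\<close> can be differentiated there through
    \<open>F\<close>.\<close>
  have evd: "\<forall>\<^sub>F y in nhds y0. F y = deriv P y"
    using evS by eventually_elim (metis DERIV_imp_deriv P)
  obtain \<tau> where \<tau>: "0 < y0" "returns y0 \<tau>" using S assms(2) by blast
  have "\<forall>\<^sub>F z in nhds y0. \<exists>\<tau>. returns z \<tau>"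
    using evS by eventually_elim (use S in blast)
  from return_neg[OF \<tau> this] have p: "P y0 < 0" and Py0: "P y0 = Y y0 \<tau>"
    using left_half_map_eq[OF \<tau>] by (simp_all add: P_def)
  have w0: "0 < W y0" using W_pos[OF \<tau>(2,1)] .
  have w1: "0 < W (P y0)" using return_W[OF \<tau>(2)] w0 Py0 by simp
  have Fneg: "F y0 < 0" unfolding F_def using p w0 w1 \<tau>
    by (intro divide_pos_neg mult_pos_pos mult_neg_pos) auto
  have dW: "(W has_real_derivative 2 * D * y - a * T) (at y)" for y
    unfolding W_def[abs_def] by (rule derivative_eq_intros refl | simp)+
  have WP: "((\<lambda>y. W (P y)) has_real_derivative (2 * D * P y0 - a * T) * F y0) (at y0)"
    by (rule DERIV_chain2[OF dW P[OF assms(2)]])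
  define G where "G = ((W (P y0) + y0 * ((2 * D * P y0 - a * T) * F y0)) * (P y0 * W y0)
      - y0 * W (P y0) * (F y0 * W y0 + P y0 * (2 * D * y0 - a * T))) / (P y0 * W y0)\<^sup>2"
  have dF: "(F has_real_derivative G) (at y0)"
    unfolding F_def[abs_def] G_def
    apply (rule derivative_eq_intros WP P[OF assms(2)] dW refl)+
    using p w0 by (simp_all add: F_def power2_eq_square algebra_simps)
  \<comment> \<open>Fact \<open>k\<close> trades \<open>W (P y0)\<close> for \<open>F y0\<close>. By
    \<open>W'\<close> the terms linear in \<open>T\<close> drop out, and \<open>(P y0)\<^sup>2 *
    (a\<^sup>2 - D * y0\<^sup>2) + y0\<^sup>2 * (D * (P y0)\<^sup>2 - a\<^sup>2)\<close> collapses
    to \<open>a\<^sup>2 * ((P y0)\<^sup>2 - y0\<^sup>2)\<close>.\<close>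
  have "G = F y0 * (a\<^sup>2 * ((P y0)\<^sup>2 - y0\<^sup>2) / (y0 * (P y0)\<^sup>2 * W y0))"
  proof -
    have k: "y0 * W (P y0) = F y0 * (P y0 * W y0)" using p w0 by (simp add: F_def)
    have W': "W y0 - y0 * (2 * D * y0 - a * T) = a\<^sup>2 - D * y0\<^sup>2"
      "P y0 * (2 * D * P y0 - a * T) - W (P y0) = D * (P y0)\<^sup>2 - a\<^sup>2"
      by (simp_all add: W_def power2_eq_square algebra_simps)
    have "y0 * ((W (P y0) + y0 * ((2 * D * P y0 - a * T) * F y0)) * (P y0 * W y0)
      - y0 * W (P y0) * (F y0 * W y0 + P y0 * (2 * D * y0 - a * T)))
      = (y0 * W (P y0)) * P y0 * (W y0 - y0 * (2 * D * y0 - a * T))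
        + F y0 * y0\<^sup>2 * W y0 * (P y0 * (2 * D * P y0 - a * T) - W (P y0))"
      by (simp add: power2_eq_square algebra_simps)
    also have "\<dots> = F y0 * W y0 * (a\<^sup>2 * ((P y0)\<^sup>2 - y0\<^sup>2))"
      unfolding k W' by (simp add: power2_eq_square algebra_simps)
    finally have "y0 * ((W (P y0) + y0 * ((2 * D * P y0 - a * T) * F y0)) * (P y0 * W y0)
      - y0 * W (P y0) * (F y0 * W y0 + P y0 * (2 * D * y0 - a * T)))
      = F y0 * W y0 * (a\<^sup>2 * ((P y0)\<^sup>2 - y0\<^sup>2))" .
    then have "(W (P y0) + y0 * ((2 * D * P y0 - a * T) * F y0)) * (P y0 * W y0)
      - y0 * W (P y0) * (F y0 * W y0 + P y0 * (2 * D * y0 - a * T))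
      = F y0 * W y0 * (a\<^sup>2 * ((P y0)\<^sup>2 - y0\<^sup>2)) / y0"
      using \<tau>(1) by (metis nonzero_mult_div_cancel_left order_less_irrefl)
    then show ?thesis using \<tau>(1) p w0 unfolding G_def by (simp add: power2_eq_square)
  qed
  then have "sgn G = - (sgn (a\<^sup>2) * sgn ((P y0)\<^sup>2 - y0\<^sup>2))"
    using Fneg p w0 \<tau>(1) by (simp add: sgn_mult sgn_divide)
  also have "\<dots> = - sgn (a\<^sup>2 * T)"
    using return_energy[OF \<tau>(2,1)] Py0 by (simp add: sgn_mult)
  finally have sgnG: "sgn G = - sgn (a\<^sup>2 * T)" .
  have dd: "(deriv P has_real_derivative G) (at y0)"
    using dF DERIV_cong_ev[OF refl evd refl] by blast
  have "\<forall>\<^sub>F y in nhds y0. P differentiable (at y)"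
    using evS by eventually_elim (use P in \<open>auto simp: real_differentiable_def\<close>)
  moreover have "deriv P differentiable (at y0)"
    using dd by (auto simp: real_differentiable_def)
  ultimately show ?thesis
    using DERIV_imp_deriv[OF dd] sgnG by (simp add: P_def)
qed

end

section \<open>Construction of the flow from orbits of domain points\<close>

theorem proposition7:
  fixes T D a :: real
  assumes "a\<^sup>2 + D\<^sup>2 \<noteq> 0"
  shows "\<forall>y0 \<in> interior (left_half_map_domain T D a).
           (\<forall>\<^sub>F y in nhds y0. left_half_map T D a differentiable (at y)) \<and>
           deriv (left_half_map T D a) differentiable (at y0) \<and>
           sgn (deriv (deriv (left_half_map T D a)) y0) = - sgn (a\<^sup>2 * T)"
proof
  fix y0
  define S where "S = interior (left_half_map_domain T D a)"
  assume "y0 \<in> interior (left_half_map_domain T D a)"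
  then have y0: "y0 \<in> S" by (simp add: S_def)
  have S: "open S" "S \<subseteq> left_half_map_domain T D a" by (auto simp: S_def interior_subset)
  have "left_half_map_domain T D a \<subseteq> {0..}"
    by (auto simp: left_half_map_domain_def left_half_map_graph_def left_return_def)
  from interior_mono[OF this] have pos: "\<And>y. y \<in> S \<Longrightarrow> 0 < y" by (auto simp: S_def)
  have ex: "\<exists>\<phi>. is_solution T D a \<phi> \<and> \<phi> 0 = (0, y)" if "y \<in> S" for y
  proof -
    have "y \<in> left_half_map_domain T D a" "y \<noteq> 0" using that S pos by force+
    then show ?thesis
      by (auto simp: left_half_map_domain_def left_half_map_graph_def left_return_def)
  qed
  obtain e where e: "0 < e" "ball y0 e \<subseteq> S" using S(1) y0 by (meson open_contains_ball)
  \<comment> \<open>Two orbits from the domain yield the whole family: their difference divided by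
    \<open>h\<close> is the homogeneous solution from \<open>(0, 1)\<close>, and subtracting
    \<open>y0\<close> times it from the orbit of \<open>y0\<close> leaves the solution through the
    origin.\<close>
  define h where "h = e / 2"
  have h: "0 < h" "y0 + h \<in> S" using e by (auto simp: h_def dist_real_def intro!: subsetD[OF e(2)])
  obtain f where f: "is_solution T D a f" "f 0 = (0, y0)" using ex[OF y0] by blast
  obtain g where g: "is_solution T D a g" "g 0 = (0, y0 + h)" using ex[OF h(2)] by blast
  define s where "s t = (fst (g t) - fst (f t)) / h" for t
  define u where "u t = (snd (g t) - snd (f t)) / h" for t
  define x where "x t = fst (f t) - y0 * s t" for t
  define r where "r t = snd (f t) - y0 * u t" for t
  have df: "((\<lambda>t. fst (f t)) has_real_derivative T * fst (f t) - snd (f t)) (at t)"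
      "((\<lambda>t. snd (f t)) has_real_derivative D * fst (f t) - a) (at t)"
    and dg: "((\<lambda>t. fst (g t)) has_real_derivative T * fst (g t) - snd (g t)) (at t)"
      "((\<lambda>t. snd (g t)) has_real_derivative D * fst (g t) - a) (at t)" for t
    using f(1) g(1) by (auto simp: is_solution_iff)
  have s: "(s has_real_derivative T * s t - u t) (at t)" for t
    unfolding s_def[abs_def] u_def
    by (rule DERIV_cong[OF DERIV_cdivide[OF DERIV_diff[OF dg(1) df(1)]]])
      (use h in \<open>simp add: field_simps\<close>)
  have u: "(u has_real_derivative D * s t) (at t)" for t
    unfolding s_def u_def[abs_def]
    by (rule DERIV_cong[OF DERIV_cdivide[OF DERIV_diff[OF dg(2) df(2)]]])
      (use h in \<open>simp add: field_simps\<close>)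
  interpret planar_flow T D a x r s u
  proof
    show "(x has_real_derivative T * x t - r t) (at t)" for t
      unfolding x_def[abs_def] r_def
      by (rule DERIV_cong[OF DERIV_diff[OF df(1) DERIV_cmult[OF s]]]) (simp add: algebra_simps)
    show "(r has_real_derivative D * x t - a) (at t)" for t
      unfolding x_def r_def[abs_def]
      by (rule DERIV_cong[OF DERIV_diff[OF df(2) DERIV_cmult[OF u]]]) (simp add: algebra_simps)
  qed (use f(2) g(2) h(1) s u in \<open>auto simp: x_def r_def s_def u_def\<close>)
  show "(\<forall>\<^sub>F y in nhds y0. left_half_map T D a differentiable (at y)) \<and>
    deriv (left_half_map T D a) differentiable (at y0) \<and>
    sgn (deriv (deriv (left_half_map T D a)) y0) = - sgn (a\<^sup>2 * T)"
    using half_map_second_deriv[OF S(1) y0] domain_returns pos S(2) by blast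
qed

end
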